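(* For every Godrèche--Lançon--Billard (GLB) tiling $\mathcal{T}$ of the plane, with vertex set $V(\mathcal{T})$, there exist infinitely many frieze patterns $f\colon V(\mathcal{T})\to\mathbb{Z}_{>0}$ on $\mathcal{T}$ each of which takes exactly three distinct values.
   Context: Rhombuses. All rhombuses have unit side length. The thick rhombus has interior angles $72^\circ$ and $108^\circ$; the thin rhombus has interior angles $36^\circ$ and $144^\circ$. A decorated tile is a rhombus in the plane $\mathbb{C}$ given with its vertices listed in cyclic order as $(m,t,o,s)$, where $m$ (the marked vertex) is a $72^\circ$ corner if the rhombus is thick and a $144^\circ$ corner if it is thin. So $o$ is opposite to $m$, and $t,s$ are the neighbours of $m$. (The vertex $t$ records an arrow along the edge from $t$ to $m$.) The cyclic order may be clockwise or counterclockwise. GLB substitution $\sigma$. Let $\lambda=2\cos(\pi/10)=\sqrt{(5+\sqrt5)/2}$. Given a decorated tile $(m,t,o,s)$, put $M=\lambda m$, $T=\lambda t$, $O=\lambda o$, $S=\lambda s$, and let $R$ be the rhombus with vertices $M,T,O,S$. For a side $XY$ of $R$ (of length $\lambda$), there are exactly two points at distance $1$ from both $X$ and $Y$; the inner apex of $XY$ is the one on the same side of the line $XY$ as $R$, and the outer apex is the other one. If the tile is thick, let $C$ be the inner apex of $MT$, $A$ the inner apex of $TO$, $E$ the outer apex of $MS$, $G$ the outer apex of $OS$, and $F=A+C-T$. Then $\sigma(m,t,o,s)$ consists of the three decorated thick tiles $(T,C,F,A)$, $(M,E,F,C)$, $(O,A,F,G)$ and the decorated thin tile $(S,G,F,E)$.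 If the tile is thin, let $w$ be the inner apex of $MT$ (which coincides with the inner apex of $TO$), $u$ the outer apex of $MS$, $v$ the outer apex of $OS$, and $x=u+v-S$. Then $\sigma(m,t,o,s)$ consists of the decorated thick tile $(S,v,x,u)$ and the two decorated thin tiles $(M,u,x,w)$, $(O,w,x,v)$. For a collection of decorated tiles, $\sigma$ is applied to every tile of the collection, and $\sigma^k$ denotes the $k$-fold iterate. GLB tilings. A GLB tiling is an edge-to-edge tiling of the plane by thick and thin rhombuses for which there is a decorated tile $P$ such that each finite patch of the tiling occurs, up to translation (and forgetting decorations), in $\sigma^k(P)$ for some $k\geq 1$. Frieze pattern. A frieze pattern on a tiling $\mathcal{T}$ by thick and thin rhombuses is a map $f$ from the set $V(\mathcal{T})$ of vertices of the tiles to the positive integers such that every tile satisfies the diamond rule $bc-ad=1$. Here $a,d$ are the values of $f$ at one pair of opposite vertices and $b,c$ are the values at the other pair, where: for a thick rhombus, $a,d$ are the values at the two $72^\circ$ corners and $b,c$ those at the two $108^\circ$ corners; for a thin rhombus, $a,d$ are the values at the two $144^\circ$ corners and $b,c$ those at the two $36^\circ$ corners. *)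

theory Defs
  imports "HOL-Analysis.Analysis"
begin

text \<open>A decorated tile \<open>(m, t, q, s)\<close> lists its vertices in cyclic order; \<open>m\<close> is the marked
  vertex, \<open>q\<close> the vertex opposite to it (the letter \<open>o\<close> is reserved syntax).\<close>

type_synonym dtile = "complex \<times> complex \<times> complex \<times> complex"

definition corner_angle :: "complex \<Rightarrow> complex \<Rightarrow> complex \<Rightarrow> real" where
  "corner_angle x p y = \<bar>Arg ((x - p) / (y - p))\<bar>"

text \<open>A quadrilateral \<open>m, t, q, s\<close> with \<open>m + q = t + s\<close> is a parallelogram, so two adjacent
  sides of length 1 make it a rhombus with unit sides.\<close>

fun unit_rhombus :: "dtile \<Rightarrow> bool" where
  "unit_rhombus (m, t, q, s) \<longleftrightarrow> m + q = t + s \<and> dist m t = 1 \<and> dist m s = 1"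

fun thick :: "dtile \<Rightarrow> bool" where
  "thick (m, t, q, s) \<longleftrightarrow> unit_rhombus (m, t, q, s) \<and> corner_angle t m s = 2 * pi / 5"

fun thin :: "dtile \<Rightarrow> bool" where
  "thin (m, t, q, s) \<longleftrightarrow> unit_rhombus (m, t, q, s) \<and> corner_angle t m s = 4 * pi / 5"

text \<open>The underlying rhombus, as a closed region; this forgets the decoration.\<close>

fun rhomb :: "dtile \<Rightarrow> complex set" where
  "rhomb (m, t, q, s) = convex hull {m, t, q, s}"

definition glb_scale :: real where
  "glb_scale = 2 * cos (pi / 10)"

definition same_side :: "complex \<Rightarrow> complex \<Rightarrow> complex \<Rightarrow> complex \<Rightarrow> bool" where
  "same_side X Y p p' \<longleftrightarrow> Im ((p - X) / (Y - X)) * Im ((p' - X) / (Y - X)) > 0"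

text \<open>The side of the line \<open>XY\<close> on which a rhombus with side \<open>XY\<close> lies is the side containing its
  centre, which is passed as the argument \<open>K\<close>.\<close>

definition inner_apex :: "complex \<Rightarrow> complex \<Rightarrow> complex \<Rightarrow> complex" where
  "inner_apex K X Y = (THE p. dist p X = 1 \<and> dist p Y = 1 \<and> same_side X Y p K)"

definition outer_apex :: "complex \<Rightarrow> complex \<Rightarrow> complex \<Rightarrow> complex" where
  "outer_apex K X Y = (THE p. dist p X = 1 \<and> dist p Y = 1 \<and> \<not> same_side X Y p K)"

fun glb_subst :: "dtile \<Rightarrow> dtile set" where
  "glb_subst (m, t, q, s) =
    (let M = glb_scale *\<^sub>R m; T = glb_scale *\<^sub>R t; Q = glb_scale *\<^sub>R q; S = glb_scale *\<^sub>R s;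
         K = (M + Q) / 2
     in if thick (m, t, q, s) then
          (let C = inner_apex K M T; A = inner_apex K T Q;
               E = outer_apex K M S; G = outer_apex K Q S; F = A + C - T
           in {(T, C, F, A), (M, E, F, C), (Q, A, F, G), (S, G, F, E)})
        else if thin (m, t, q, s) then
          (let w = inner_apex K M T; u = outer_apex K M S; v = outer_apex K Q S; x = u + v - S
           in {(S, v, x, u), (M, u, x, w), (Q, w, x, v)})
        else {})"

definition glb_subst_set :: "dtile set \<Rightarrow> dtile set" where
  "glb_subst_set P = (\<Union>d\<in>P. glb_subst d)"

text \<open>The faces of a rhombus are the empty set, its vertices, its edges and the rhombus itself.\<close>

definition rhombus_tiling :: "complex set set \<Rightarrow> bool" where
  "rhombus_tiling \<T> \<longleftrightarrow>
     (\<forall>R\<in>\<T>. \<exists>d. (thick d \<or> thin d) \<and> R = rhomb d) \<and>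
     \<Union>\<T> = UNIV \<and>
     (\<forall>R\<in>\<T>. \<forall>R'\<in>\<T>. R \<noteq> R' \<longrightarrow>
        interior R \<inter> interior R' = {} \<and> (R \<inter> R') face_of R \<and> (R \<inter> R') face_of R')"

definition vertices :: "complex set set \<Rightarrow> complex set" where
  "vertices \<T> = {x. \<exists>R\<in>\<T>. x extreme_point_of R}"

definition glb_tiling :: "complex set set \<Rightarrow> bool" where
  "glb_tiling \<T> \<longleftrightarrow> rhombus_tiling \<T> \<and>
     (\<exists>P. (thick P \<or> thin P) \<and>
        (\<forall>\<F>. finite \<F> \<and> \<F> \<subseteq> \<T> \<longrightarrow>
           (\<exists>k\<ge>1. \<exists>z. (\<lambda>R. (\<lambda>x. z + x) ` R) ` \<F> \<subseteq> rhomb ` ((glb_subst_set ^^ k) {P}))))"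

text \<open>In a decorated thick tile \<open>(m, t, q, s)\<close> the \<open>72\<close> degree corners are \<open>m, q\<close> and the \<open>108\<close>
  degree corners are \<open>t, s\<close>; in a thin one the \<open>144\<close> degree corners are \<open>m, q\<close> and the \<open>36\<close>
  degree corners are \<open>t, s\<close>.  So the diamond rule has the same form in both cases.  Frieze
  patterns are taken to be extensional functions, so that two of them are equal iff they agree
  on all vertices.\<close>

definition frieze_pattern :: "complex set set \<Rightarrow> (complex \<Rightarrow> int) \<Rightarrow> bool" where
  "frieze_pattern \<T> f \<longleftrightarrow> f \<in> vertices \<T> \<rightarrow>\<^sub>E {0<..} \<and>
     (\<forall>m t q s. (thick (m, t, q, s) \<or> thin (m, t, q, s)) \<and> rhomb (m, t, q, s) \<in> \<T> \<longrightarrow>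
        f t * f s - f m * f q = 1)"

end

theory Submission
  imports Defs
begin

text \<open>Let \<open>\<zeta> = cis (\<pi>/5)\<close>. Up to one similarity of the plane, every edge of a patch
  \<open>\<sigma>\<^sup>k(P)\<close> is a tenth root of unity, so all its vertices lie in the ring \<open>\<int>[\<zeta>]\<close>. The minimal
  polynomial \<open>1 - x + x\<^sup>2 - x\<^sup>3 + x\<^sup>4\<close> of \<open>\<zeta>\<close> takes the value \<open>5\<close> at \<open>-1\<close>, hence \<open>\<zeta> \<mapsto> -1\<close> defines a
  ring homomorphism from \<open>\<int>[\<zeta>]\<close> to the integers modulo \<open>5\<close>; call its value the index.

  In a decorated tile \<open>(m, t, q, s)\<close> the two edges at \<open>m\<close> differ by a rotation through a multiple of
  \<open>72\<close> degrees, that is, by an even power of \<open>\<zeta>\<close>, and so they have the same index \<open>1\<close> or \<open>-1\<close>.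
  If \<open>m\<close> has index \<open>0\<close>, then \<open>t\<close> and \<open>s\<close> have index \<open>1\<close> or \<open>-1\<close>, and \<open>q\<close> has index \<open>2\<close> or \<open>-2\<close>.
  These are three different classes modulo \<open>5\<close> and sign, so the values \<open>n\<close>, \<open>n + 1\<close>, \<open>n + 2\<close> on
  them are well defined at each vertex, and the diamond rule becomes \<open>(n + 1)\<^sup>2 - n (n + 2) = 1\<close>.

  Marked corners do have index \<open>0\<close>. The marked corners of the tiles in \<open>\<sigma>(d)\<close> are the scaled
  vertices of \<open>d\<close>, and scaling by \<open>\<lambda> = \<eta> + \<eta>\<^sup>-\<^sup>1\<close> with \<open>\<eta> = cis (\<pi>/10)\<close> amounts to turning by \<open>\<eta>\<close>
  (which turns all edges alike) and multiplying by \<open>1 + \<zeta>\<^sup>-\<^sup>1\<close>, which has index \<open>0\<close>; this is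
  \<open>index_class_scale\<close>, and \<open>marked_in_glb_subst\<close> is the resulting invariant of the substitution.

  A tiling only contains undecorated patches, each with an origin of its own for the index. Fixing one
  tile of the tiling leaves four choices for the origin and the unit, so one of them works for
  all finite patches and hence for all tiles at once: \<open>glb_tiling_marked\<close>.\<close>

section \<open>The index modulo 5 on the tenth cyclotomic integers\<close>

definition zeta :: complex where
  "zeta = cis (pi / 5)"

definition eta :: complex where
  "eta = cis (pi / 10)"

lemma cyclotomic_relation: "zeta ^ 4 = zeta ^ 3 - zeta ^ 2 + zeta - 1"
proof -
  have "sin (pi / 5) > 0"
    by (intro sin_gt_zero) auto
  then have "Im (1 + zeta) \<noteq> 0"
    by (simp add: zeta_def)
  then have "1 + zeta \<noteq> 0"
    by force
  moreover have "zeta ^ 5 = -1"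
    unfolding zeta_def Complex.DeMoivre by simp
  then have "(1 + zeta) * (zeta ^ 4 - zeta ^ 3 + zeta ^ 2 - zeta + 1) = 0"
    by (simp add: algebra_simps power2_eq_square power3_eq_cube power4_eq_xxxx eval_nat_numeral)
  ultimately have "zeta ^ 4 - zeta ^ 3 + zeta ^ 2 - zeta + 1 = 0"
    by (simp only: mult_eq_0_iff simp_thms)
  then show ?thesis
    by (simp add: algebra_simps)
qed

lemma cos_36_quadratic: "4 * cos (pi / 5) ^ 2 - 2 * cos (pi / 5) = (1 :: real)"
proof -
  define c where "c = cos (pi / 5)"
  have s: "sin (pi / 5) ^ 2 = 1 - c ^ 2"
    by (simp add: c_def sin_squared_eq)
  have "zeta ^ 2 + cnj zeta ^ 2 - (zeta + cnj zeta) + 1 = 0"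
  proof -
    have "zeta * cnj zeta = 1"
      by (simp add: zeta_def cis_cnj cis_mult)
    then have "zeta ^ 2 * (zeta ^ 2 + cnj zeta ^ 2 - (zeta + cnj zeta) + 1)
        = zeta ^ 4 - zeta ^ 3 + zeta ^ 2 - zeta + 1"
      by algebra
    also have "\<dots> = 0"
      using cyclotomic_relation by simp
    finally show ?thesis
      by (simp add: zeta_def)
  qed
  then have "Re (zeta ^ 2 + cnj zeta ^ 2 - (zeta + cnj zeta) + 1) = 0"
    by simp
  then have "2 * (c ^ 2 - sin (pi / 5) ^ 2) - 2 * c + 1 = 0"
    by (simp add: zeta_def c_def power2_eq_square)
  then show ?thesis
    using s unfolding c_def by simp
qed

text \<open>The prime \<open>5\<close> has even multiplicity in \<open>a\<^sup>2\<close> and odd multiplicity in \<open>5 b\<^sup>2\<close>.\<close>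

lemma no_int_square_eq_5_times_square:
  fixes a b :: int
  assumes "a ^ 2 = 5 * b ^ 2"
  shows "b = 0"
proof (rule ccontr)
  assume b: "b \<noteq> 0"
  then have a: "a \<noteq> 0"
    using assms by auto
  have p: "prime (5 :: int)"
    by simp
  have "multiplicity 5 (a ^ 2) = 2 * multiplicity 5 a"
    using p a by (simp add: prime_elem_multiplicity_power_distrib)
  moreover have "multiplicity 5 (5 * b ^ 2) = 1 + 2 * multiplicity 5 b"
    using p b by (simp add: prime_elem_multiplicity_mult_distrib
        prime_elem_multiplicity_power_distrib multiplicity_same_power)
  ultimately have "2 * multiplicity 5 a = 1 + 2 * multiplicity 5 b"
    using assms by metis
  then show False
    by presburger
qed

text \<open>By \<open>cos_36_quadratic\<close>, the square of \<open>4 cos (\<pi>/5) - 1\<close> is \<open>5\<close>.\<close>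

lemma cos_36_irrational:
  fixes u v :: int
  assumes "of_int u + of_int v * cos (pi / 5) = (0 :: real)"
  shows "u = 0 \<and> v = 0"
proof -
  define c where "c = cos (pi / 5)"
  have q: "(4 * c - 1) ^ 2 = 5"
    using cos_36_quadratic by (simp add: c_def power2_eq_square algebra_simps)
  have "of_int v * (4 * c - 1) = - of_int (4 * u + v)"
    using assms by (simp add: c_def algebra_simps)
  then have "(of_int v * (4 * c - 1)) ^ 2 = (of_int (4 * u + v)) ^ 2"
    by (simp only: power2_minus)
  then have "of_int v ^ 2 * 5 = (of_int (4 * u + v) :: real) ^ 2"
    unfolding power_mult_distrib q .
  then have "(of_int ((4 * u + v) ^ 2) :: real) = of_int (5 * v ^ 2)"
    by (simp add: mult.commute)
  then have "(4 * u + v) ^ 2 = 5 * v ^ 2"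
    by (simp only: of_int_eq_iff)
  then have "v = 0"
    by (rule no_int_square_eq_5_times_square)
  then show ?thesis
    using assms by simp
qed

text \<open>With \<open>c = cos (\<pi>/5)\<close>, the real parts of the powers of \<open>\<zeta>\<close>, and their imaginary parts divided
  by \<open>sin (\<pi>/5)\<close>, are rational linear functions of \<open>c\<close>, so the irrationality of \<open>c\<close> turns one
  complex equation into four rational ones. This independence is what makes the index well defined.\<close>

lemma zeta_powers_independent:
  fixes n0 n1 n2 n3 :: int
  assumes "of_int n0 + of_int n1 * zeta + of_int n2 * zeta ^ 2 + of_int n3 * zeta ^ 3 = 0"
  shows "n0 = 0 \<and> n1 = 0 \<and> n2 = 0 \<and> n3 = 0"
proof -
  define c where "c = cos (pi / 5)"
  define s where "s = sin (pi / 5)"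
  have s: "s > 0"
    unfolding s_def by (intro sin_gt_zero) auto
  have sc: "s ^ 2 = 1 - c ^ 2"
    by (simp add: c_def s_def sin_squared_eq)
  have cc: "c ^ 2 = c / 2 + 1 / 4"
    using cos_36_quadratic by (simp add: c_def)
  have z: "zeta = Complex c s"
    by (simp add: zeta_def c_def s_def complex_eq_iff)
  have z2: "zeta ^ 2 = Complex (c - 1 / 2) (2 * c * s)"
    using sc cc by (simp add: z complex_eq_iff power2_eq_square)
  have "zeta ^ 3 = zeta ^ 2 * zeta"
    by (simp add: power3_eq_cube power2_eq_square)
  also have "\<dots> = Complex (c * c - c / 2 - 2 * c * (s * s)) (c * s - s / 2 + 2 * (c * c) * s)"
    by (simp add: z2, simp add: z complex_eq_iff algebra_simps)
  also have "c * c - c / 2 - 2 * c * (s * s) = 1 / 2 - c"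
  proof -
    have "2 * c * (s * s) = c - 1 / 4"
    proof -
      have "2 * c * (s * s) = 2 * c - 2 * c * c ^ 2"
        unfolding sc[unfolded power2_eq_square] by (simp add: power2_eq_square algebra_simps)
      also have "\<dots> = 2 * c - 2 * c * (c / 2 + 1 / 4)"
        unfolding cc ..
      also have "\<dots> = 2 * c - c ^ 2 - c / 2"
        by (simp add: power2_eq_square algebra_simps)
      also have "\<dots> = c - 1 / 4"
        unfolding cc by simp
      finally show ?thesis .
    qed
    then show ?thesis
      using cc by (simp add: power2_eq_square)
  qed
  also have "c * s - s / 2 + 2 * (c * c) * s = 2 * c * s"
    using cc by (simp add: power2_eq_square algebra_simps)
  finally have z3: "zeta ^ 3 = Complex (1 / 2 - c) (2 * c * s)" .
  have "Re (of_int n0 + of_int n1 * zeta + of_int n2 * zeta ^ 2 + of_int n3 * zeta ^ 3) = 0"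
    using assms by simp
  then have "of_int (2 * n0 - n2 + n3) + of_int (2 * (n1 + n2 - n3)) * c = (0 :: real)"
    unfolding z2 z3 unfolding z by (simp add: algebra_simps)
  then have re: "2 * n0 - n2 + n3 = 0 \<and> 2 * (n1 + n2 - n3) = 0"
    unfolding c_def by (rule cos_36_irrational)
  have "Im (of_int n0 + of_int n1 * zeta + of_int n2 * zeta ^ 2 + of_int n3 * zeta ^ 3) = 0"
    using assms by simp
  then have "s * (of_int n1 + of_int (2 * (n2 + n3)) * c) = 0"
    unfolding z2 z3 unfolding z by (simp add: algebra_simps)
  then have "of_int n1 + of_int (2 * (n2 + n3)) * c = (0 :: real)"
    using s by simp
  then have im: "n1 = 0 \<and> 2 * (n2 + n3) = 0"
    unfolding c_def by (rule cos_36_irrational)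
  show ?thesis
    using re im by auto
qed

text \<open>The fibre over \<open>j\<close>, modulo \<open>5\<close>, of the ring homomorphism with \<open>\<zeta> \<mapsto> -1\<close>. Working with fibres
  avoids a choice of coefficients for elements of \<open>\<int>[\<zeta>]\<close>.\<close>

definition index_class :: "int \<Rightarrow> complex set" where
  "index_class j = {of_int n0 + of_int n1 * zeta + of_int n2 * zeta ^ 2 + of_int n3 * zeta ^ 3
     | n0 n1 n2 n3. 5 dvd n0 - n1 + n2 - n3 - j}"

lemma index_classI:
  assumes "x = of_int n0 + of_int n1 * zeta + of_int n2 * zeta ^ 2 + of_int n3 * zeta ^ 3"
    and "5 dvd n0 - n1 + n2 - n3 - j"
  shows "x \<in> index_class j"
  using assms unfolding index_class_def by blast

lemma index_classE:
  assumes "x \<in> index_class j"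
  obtains n0 n1 n2 n3
  where "x = of_int n0 + of_int n1 * zeta + of_int n2 * zeta ^ 2 + of_int n3 * zeta ^ 3"
    and "5 dvd n0 - n1 + n2 - n3 - j"
  using assms unfolding index_class_def by blast

lemma index_class_unique:
  assumes "x \<in> index_class i" and "x \<in> index_class j"
  shows "5 dvd i - j"
proof -
  obtain n0 n1 n2 n3
    where n: "x = of_int n0 + of_int n1 * zeta + of_int n2 * zeta ^ 2 + of_int n3 * zeta ^ 3"
      and i: "5 dvd n0 - n1 + n2 - n3 - i"
    using assms(1) by (rule index_classE)
  obtain k0 k1 k2 k3
    where k: "x = of_int k0 + of_int k1 * zeta + of_int k2 * zeta ^ 2 + of_int k3 * zeta ^ 3"
      and j: "5 dvd k0 - k1 + k2 - k3 - j"
    using assms(2) by (rule index_classE)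
  have "of_int (n0 - k0) + of_int (n1 - k1) * zeta + of_int (n2 - k2) * zeta ^ 2
      + of_int (n3 - k3) * zeta ^ 3 = 0"
    using n k by (simp add: algebra_simps)
  then have "n0 - k0 = 0 \<and> n1 - k1 = 0 \<and> n2 - k2 = 0 \<and> n3 - k3 = 0"
    by (rule zeta_powers_independent)
  then have "i - j = (k0 - k1 + k2 - k3 - j) - (n0 - n1 + n2 - n3 - i)"
    by simp
  then show ?thesis
    using dvd_diff[OF j i] by (simp only:)
qed

lemma zero_in_index_class: "0 \<in> index_class 0"
  by (rule index_classI[of _ 0 0 0 0]) auto

lemma one_in_index_class: "1 \<in> index_class 1"
  by (rule index_classI[of _ 1 0 0 0]) auto

lemma index_class_add:
  assumes "x \<in> index_class i" and "y \<in> index_class j"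
  shows "x + y \<in> index_class (i + j)"
proof -
  obtain n0 n1 n2 n3
    where n: "x = of_int n0 + of_int n1 * zeta + of_int n2 * zeta ^ 2 + of_int n3 * zeta ^ 3"
      and i: "5 dvd n0 - n1 + n2 - n3 - i"
    using assms(1) by (rule index_classE)
  obtain k0 k1 k2 k3
    where k: "y = of_int k0 + of_int k1 * zeta + of_int k2 * zeta ^ 2 + of_int k3 * zeta ^ 3"
      and j: "5 dvd k0 - k1 + k2 - k3 - j"
    using assms(2) by (rule index_classE)
  show ?thesis
  proof (rule index_classI)
    show "x + y = of_int (n0 + k0) + of_int (n1 + k1) * zeta + of_int (n2 + k2) * zeta ^ 2
        + of_int (n3 + k3) * zeta ^ 3"
      by (simp add: n k algebra_simps)
    show "5 dvd n0 + k0 - (n1 + k1) + (n2 + k2) - (n3 + k3) - (i + j)"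
      using dvd_add[OF i j] by (simp add: algebra_simps)
  qed
qed

lemma index_class_uminus:
  assumes "x \<in> index_class i"
  shows "- x \<in> index_class (- i)"
proof -
  obtain n0 n1 n2 n3
    where n: "x = of_int n0 + of_int n1 * zeta + of_int n2 * zeta ^ 2 + of_int n3 * zeta ^ 3"
      and i: "5 dvd n0 - n1 + n2 - n3 - i"
    using assms by (rule index_classE)
  show ?thesis
  proof (rule index_classI)
    show "- x = of_int (- n0) + of_int (- n1) * zeta + of_int (- n2) * zeta ^ 2
        + of_int (- n3) * zeta ^ 3"
      by (simp add: n)
    show "5 dvd - n0 - - n1 + - n2 - - n3 - - i"
      using dvd_minus_iff[THEN iffD2, OF i] by (simp add: algebra_simps)
  qed
qed

lemma index_class_diff:
  assumes "x \<in> index_class i" and "y \<in> index_class j"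
  shows "x - y \<in> index_class (i - j)"
  using index_class_add[OF assms(1) index_class_uminus[OF assms(2)]] by simp

lemma index_class_zeta_mult:
  assumes "x \<in> index_class i"
  shows "zeta * x \<in> index_class (- i)"
proof -
  obtain n0 n1 n2 n3
    where n: "x = of_int n0 + of_int n1 * zeta + of_int n2 * zeta ^ 2 + of_int n3 * zeta ^ 3"
      and i: "5 dvd n0 - n1 + n2 - n3 - i"
    using assms by (rule index_classE)
  \<comment> \<open>Reducing \<open>\<zeta>\<^sup>4\<close> changes the alternating sum of the coefficients by a multiple of \<open>5\<close>.\<close>
  have "zeta * x = of_int n0 * zeta + of_int n1 * zeta ^ 2 + of_int n2 * zeta ^ 3
      + of_int n3 * zeta ^ 4"
    by (simp add: n algebra_simps eval_nat_numeral)
  also have "\<dots> = of_int (- n3) + of_int (n0 + n3) * zeta + of_int (n1 - n3) * zeta ^ 2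
      + of_int (n2 + n3) * zeta ^ 3"
    unfolding cyclotomic_relation by (simp add: algebra_simps)
  finally show ?thesis
  proof (rule index_classI)
    have "- n3 - (n0 + n3) + (n1 - n3) - (n2 + n3) - - i = - (n0 - n1 + n2 - n3 - i) - 5 * n3"
      by simp
    then show "5 dvd - n3 - (n0 + n3) + (n1 - n3) - (n2 + n3) - - i"
      using i by (metis dvd_diff dvd_minus_iff dvd_triv_left)
  qed
qed

lemma index_class_zeta_power_mult:
  assumes "x \<in> index_class i"
  shows "zeta ^ n * x \<in> index_class ((-1) ^ n * i)"
proof (induction n)
  case (Suc n)
  then show ?case
    using index_class_zeta_mult[OF Suc] by (simp add: mult.assoc)
qed (use assms in simp)

lemma tenth_root_of_unity_eq_zeta_power:
  assumes "z ^ 10 = 1"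
  obtains n where "z = zeta ^ n"
proof -
  have "bij_betw (\<lambda>k. cis (2 * pi * real k / real 10)) {..<10} {z. z ^ 10 = 1}"
    by (rule Complex.bij_betw_roots_unity) simp
  then have "z \<in> (\<lambda>k. cis (2 * pi * real k / real 10)) ` {..<10}"
    using assms by (auto simp: bij_betw_def)
  then obtain k where "z = cis (2 * pi * real k / real 10)"
    by blast
  then have "z = zeta ^ k"
    unfolding zeta_def Complex.DeMoivre by (simp add: mult_ac)
  then show thesis
    by (rule that)
qed

lemma tenth_root_of_unity_index:
  assumes "z ^ 10 = 1"
  shows "\<exists>e\<in>{1, -1}. z \<in> index_class e"
proof -
  obtain n where "z = zeta ^ n"
    using assms by (rule tenth_root_of_unity_eq_zeta_power)
  then have "z \<in> index_class ((-1) ^ n)"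
    using index_class_zeta_power_mult[OF one_in_index_class, of n] by simp
  then show ?thesis
    by (cases "even n") auto
qed

lemma index_class_zero_root_mult:
  assumes "x \<in> index_class 0" and "z ^ 10 = 1"
  shows "z * x \<in> index_class 0"
proof -
  obtain n where "z = zeta ^ n"
    using assms(2) by (rule tenth_root_of_unity_eq_zeta_power)
  then show ?thesis
    using index_class_zeta_power_mult[OF assms(1), of n] by simp
qed

section \<open>The inflation factor\<close>

lemma eta_square: "eta ^ 2 = zeta"
  unfolding eta_def zeta_def Complex.DeMoivre by simp

lemma eta_nonzero: "eta \<noteq> 0"
  by (simp add: eta_def)

lemma norm_eta: "norm eta = 1"
  by (simp add: eta_def)

lemma eta_power_10: "eta ^ 10 = -1"
  unfolding eta_def Complex.DeMoivre by simp

lemma eta_mult_cnj: "eta * cnj eta = 1"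
  by (simp add: eta_def cis_cnj cis_mult)

lemma eta_add_cnj: "eta + cnj eta = of_real glb_scale"
  by (simp add: eta_def glb_scale_def complex_eq_iff)

lemma glb_scale_pos: "glb_scale > 0"
  unfolding glb_scale_def by (simp, intro cos_gt_zero_pi) auto

text \<open>The quotient \<open>\<lambda>/\<eta>\<close> equals \<open>1 + \<zeta>\<^sup>-\<^sup>1 = 1 - \<zeta>\<^sup>4\<close>, which the homomorphism \<open>\<zeta> \<mapsto> -1\<close> kills. This is why the
  vertices that the substitution inherits from its input form a single index class.\<close>

lemma index_class_scale:
  assumes "x \<in> index_class i"
  shows "of_real glb_scale * x / eta \<in> index_class 0"
proof -
  note eta = eta_nonzero
  have z5: "zeta ^ 5 = -1"
    unfolding zeta_def Complex.DeMoivre by simp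
  have "of_real glb_scale * eta ^ 9 = eta ^ 10 + (eta * cnj eta) * eta ^ 8"
    unfolding eta_add_cnj[symmetric] by (simp add: algebra_simps eval_nat_numeral)
  also have "\<dots> = zeta ^ 4 - 1"
    unfolding eta_mult_cnj eta_power_10 eta_square[symmetric] by simp
  finally have "of_real glb_scale * eta ^ 9 = zeta ^ 4 - 1" .
  moreover have "of_real glb_scale * x / eta = - (of_real glb_scale * eta ^ 9) * x"
  proof -
    have "1 / eta = - (eta ^ 9)"
      using eta_power_10 eta by (simp add: field_simps eval_nat_numeral)
    then show ?thesis
      by (metis (no_types, lifting) divide_inverse inverse_eq_divide mult.assoc mult.commute
          mult_minus_left mult_minus_right)
  qed
  ultimately have "of_real glb_scale * x / eta = - (zeta ^ 4 - 1) * x"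
    by (simp only:)
  then have "of_real glb_scale * x / eta = x - zeta ^ 4 * x"
    by (simp add: algebra_simps)
  then show ?thesis
    using index_class_diff[OF assms index_class_zeta_power_mult[OF assms, of 4]] by simp
qed

section \<open>Tiles and apexes in terms of turns by 18 degrees\<close>

lemma eta_power_20: "eta ^ 20 = 1"
proof -
  have "eta ^ 20 = (eta ^ 10) ^ 2"
    by (simp flip: power_mult)
  then show ?thesis
    by (simp add: eta_power_10)
qed

text \<open>The two elements correspond to the two orientations of a decorated tile: with \<open>h\<close> chosen
  according to the orientation, both orientations are described by the same formulas in powers
  of \<open>h\<close>.\<close>

definition turns :: "complex set" where
  "turns = {eta, cnj eta}"

lemma turn_norm: "h \<in> turns \<Longrightarrow> norm h = 1"
  by (auto simp: turns_def norm_eta)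

lemma turn_mult_cnj: "h \<in> turns \<Longrightarrow> h * cnj h = 1"
  using eta_mult_cnj by (auto simp: turns_def mult.commute)

lemma turn_cnj: "h \<in> turns \<Longrightarrow> cnj h \<in> turns"
  by (auto simp: turns_def)

lemma turn_add_cnj: "h \<in> turns \<Longrightarrow> h + cnj h = of_real glb_scale"
  using eta_add_cnj by (auto simp: turns_def add.commute)

lemma turn_power_10: "h \<in> turns \<Longrightarrow> h ^ 10 = -1"
  using eta_power_10 by (auto simp: turns_def simp flip: complex_cnj_power)

lemma turn_power_add_10: "h \<in> turns \<Longrightarrow> h ^ (10 + n) = - (h ^ n)"
  unfolding power_add using turn_power_10 by simp

text \<open>This holds because \<open>h\<close> itself is a power of \<open>\<eta>\<close>. For even \<open>n\<close>, which covers the angles at the marked corners,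
  multiplication by \<open>h ^ (2 * n)\<close> therefore preserves the index.\<close>

lemma turn_power_eq_zeta_power:
  assumes "h \<in> turns"
  obtains k where "h ^ (2 * n) = zeta ^ (k * n)"
proof -
  have "cnj eta = eta ^ 19"
  proof -
    have "eta * cnj eta = eta * eta ^ 19"
      using eta_power_20 eta_mult_cnj by (simp flip: power_Suc)
    then show ?thesis
      using eta_nonzero by simp
  qed
  then have "h = eta ^ 1 \<or> h = eta ^ 19"
    using assms by (auto simp: turns_def)
  then obtain k where k: "h = eta ^ k"
    by metis
  have "h ^ (2 * n) = zeta ^ (k * n)"
    by (simp add: k flip: eta_square power_mult) (simp add: mult.left_commute)
  then show thesis
    by (rule that)
qed

text \<open>Multiplication by \<open>h ^ n\<close> turns towards the same side as multiplication by \<open>h\<close> as long as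
  the total angle stays below \<open>180\<close> degrees.\<close>

lemma Im_turn_power:
  assumes "h \<in> turns" and "0 < n" and "n < 10"
  shows "Im (h ^ n) * Im h > 0"
proof -
  have "real n * (pi / 10) < pi"
    using assms(3) by simp
  then have "sin (real n * (pi / 10)) > 0"
    using assms(2) by (intro sin_gt_zero) auto
  moreover have "sin (pi / 10) > 0"
    by (intro sin_gt_zero) auto
  ultimately have "Im (eta ^ n) * Im eta > 0"
    unfolding eta_def Complex.DeMoivre by simp
  then show ?thesis
    using assms(1) by (auto simp: turns_def simp flip: complex_cnj_power)
qed

lemma abs_Arg_eq_iff:
  assumes "norm z = 1" and "0 < \<alpha>" and "\<alpha> < pi"
  shows "\<bar>Arg z\<bar> = \<alpha> \<longleftrightarrow> z = cis \<alpha> \<or> z = cis (- \<alpha>)"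
proof
  assume "\<bar>Arg z\<bar> = \<alpha>"
  moreover have "z = cis (Arg z)"
    using assms(1) cis_Arg[of z] by (cases "z = 0") (simp_all add: sgn_div_norm)
  ultimately show "z = cis \<alpha> \<or> z = cis (- \<alpha>)"
    using assms(2) by (metis abs_if minus_minus)
next
  assume "z = cis \<alpha> \<or> z = cis (- \<alpha>)"
  moreover have "Arg (cis \<alpha>) = \<alpha>" "Arg (cis (- \<alpha>)) = - \<alpha>"
    using assms(2,3) by (auto intro!: Arg_cis)
  ultimately show "\<bar>Arg z\<bar> = \<alpha>"
    using assms(2) by auto
qed

lemma rhombus_with_angle_iff:
  assumes "n \<in> {4, 8}"
  shows "unit_rhombus (m, t, q, s) \<and> corner_angle t m s = real n * (pi / 10) \<longleftrightarrow>
    norm (t - m) = 1 \<and> q = t + s - m \<and> (\<exists>h\<in>turns. s - m = (t - m) * h ^ n)"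
proof (cases "norm (t - m) = 1 \<and> norm (s - m) = 1")
  case True
  define b c where "b = t - m" and "c = s - m"
  have b: "norm b = 1" "b \<noteq> 0" and c: "norm c = 1" "c \<noteq> 0"
    using True by (auto simp: b_def c_def)
  have eta_n: "eta ^ n = cis (real n * (pi / 10))" "cnj eta ^ n = cis (- (real n * (pi / 10)))"
    unfolding eta_def cis_cnj Complex.DeMoivre by simp_all
  have inv: "b / c = x \<longleftrightarrow> c = b * y" if "x * y = 1" for x y
  proof -
    have "y \<noteq> 0"
      using that by auto
    then have "x = 1 / y"
      using that by (simp add: nonzero_eq_divide_eq)
    then show ?thesis
      using c \<open>y \<noteq> 0\<close> by (auto simp: field_simps)
  qed
  have "corner_angle t m s = real n * (pi / 10) \<longleftrightarrow> \<bar>Arg (b / c)\<bar> = real n * (pi / 10)"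
    by (simp add: corner_angle_def b_def c_def)
  also have "\<dots> \<longleftrightarrow> b / c = cis (real n * (pi / 10)) \<or> b / c = cis (- (real n * (pi / 10)))"
    using assms b c by (intro abs_Arg_eq_iff) (auto simp: norm_divide)
  also have "\<dots> \<longleftrightarrow> c = b * cnj eta ^ n \<or> c = b * eta ^ n"
    unfolding eta_n by (intro arg_cong2[where f = "(\<or>)"] inv) (simp_all add: cis_mult)
  finally have "corner_angle t m s = real n * (pi / 10) \<longleftrightarrow> (\<exists>h\<in>turns. c = b * h ^ n)"
    by (auto simp: turns_def)
  moreover have "unit_rhombus (m, t, q, s) \<longleftrightarrow> q = t + s - m"
    using True by (auto simp: dist_norm norm_minus_commute algebra_simps)
  ultimately show ?thesis
    using True by (simp add: b_def c_def)
next
  case False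
  have "norm (s - m) = norm (t - m)" if "h \<in> turns" "s - m = (t - m) * h ^ n" for h
    using that by (simp add: norm_mult norm_power turn_norm)
  then have "\<not> (norm (t - m) = 1 \<and> (\<exists>h\<in>turns. s - m = (t - m) * h ^ n))"
    using False by metis
  moreover have "\<not> unit_rhombus (m, t, q, s)"
    using False by (auto simp: dist_norm norm_minus_commute)
  ultimately show ?thesis
    by blast
qed

lemma thick_iff:
  "thick (m, t, q, s) \<longleftrightarrow>
    norm (t - m) = 1 \<and> q = t + s - m \<and> (\<exists>h\<in>turns. s - m = (t - m) * h ^ 4)"
  using rhombus_with_angle_iff[of 4 m t q s] by simp

lemma thin_iff:
  "thin (m, t, q, s) \<longleftrightarrow>
    norm (t - m) = 1 \<and> q = t + s - m \<and> (\<exists>h\<in>turns. s - m = (t - m) * h ^ 8)"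
  using rhombus_with_angle_iff[of 8 m t q s] by simp

lemma not_thick_and_thin: "\<not> (thick (m, t, q, s) \<and> thin (m, t, q, s))"
  by auto

text \<open>The unit circles around \<open>0\<close> and \<open>\<lambda>\<close> meet on the line \<open>Re z = \<lambda>/2 = Re h\<close>.\<close>

lemma unit_circle_apexes:
  assumes h: "h \<in> turns" and "norm z = 1" and "norm (z - of_real glb_scale) = 1"
  shows "z = h \<or> z = cnj h"
proof -
  have scale: "glb_scale = 2 * Re h"
    using turn_add_cnj[OF h] by (simp add: complex_eq_iff)
  have "(Re z) ^ 2 + (Im z) ^ 2 = 1" "(Re z - glb_scale) ^ 2 + (Im z) ^ 2 = 1"
    using assms(2,3) by (simp_all add: cmod_def)
  moreover have "(Re h) ^ 2 + (Im h) ^ 2 = 1"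
    using turn_norm[OF h] by (simp add: cmod_def)
  ultimately have "glb_scale * (glb_scale - 2 * Re z) = 0"
    by (simp add: power2_eq_square algebra_simps)
  then have re: "Re z = Re h"
    using glb_scale_pos scale by simp
  then have "(Im z) ^ 2 = (Im h) ^ 2"
    using \<open>(Re z) ^ 2 + (Im z) ^ 2 = 1\<close> \<open>(Re h) ^ 2 + (Im h) ^ 2 = 1\<close> by simp
  then show ?thesis
    using re by (auto simp: power2_eq_iff complex_eq_iff)
qed

text \<open>An isosceles triangle with sides \<open>1, 1, \<lambda>\<close> has base angles of \<open>18\<close> degrees, so the apexes over
  a side come from its direction \<open>b\<close> by a turn. The hypothesis on \<open>K\<close> says that \<open>h\<close> turns from the side
  towards \<open>K\<close>.\<close>

lemma apex_eq:
  assumes h: "h \<in> turns" and b: "norm b = 1" and Y: "Y = X + of_real glb_scale * b"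
    and side: "Im ((K - X) / b) * Im h > 0"
  shows "inner_apex K X Y = X + b * h" and "outer_apex K X Y = X + b * cnj h"
proof -
  have b0: "b \<noteq> 0"
    using b by auto
  have dists: "dist p X = 1 \<and> dist p Y = 1 \<longleftrightarrow> p = X + b * h \<or> p = X + b * cnj h" for p
  proof
    assume p: "dist p X = 1 \<and> dist p Y = 1"
    define z where "z = (p - X) / b"
    have pz: "p = X + b * z"
      using b0 by (simp add: z_def)
    have "norm (b * z) = 1" "norm (b * (z - of_real glb_scale)) = 1"
      using p by (simp_all add: pz Y dist_norm algebra_simps)
    then have "z = h \<or> z = cnj h"
      using b by (intro unit_circle_apexes[OF h]) (simp_all add: norm_mult)
    then show "p = X + b * h \<or> p = X + b * cnj h"
      using pz by auto
  next
    have "h - of_real glb_scale = - cnj h" "cnj h - of_real glb_scale = - h"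
      by (simp_all flip: turn_add_cnj[OF h])
    then have "norm (b * (h - of_real glb_scale)) = 1" "norm (b * (cnj h - of_real glb_scale)) = 1"
      using b turn_norm[OF h] by (simp_all add: norm_mult)
    moreover have "dist (X + b * z) X = norm (b * z)"
      and "dist (X + b * z) Y = norm (b * (z - of_real glb_scale))" for z
      by (simp_all add: Y dist_norm algebra_simps)
    moreover assume "p = X + b * h \<or> p = X + b * cnj h"
    ultimately show "dist p X = 1 \<and> dist p Y = 1"
      using b turn_norm[OF h] by (auto simp: norm_mult)
  qed
  have same_side: "same_side X Y (X + b * z) K \<longleftrightarrow> Im z * Im ((K - X) / b) > 0" for z
  proof -
    define w where "w = (K - X) / b"
    have p: "(X + b * z - X) / (Y - X) = z / of_real glb_scale"
      using b0 by (simp add: Y)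
    have K: "(K - X) / (Y - X) = w / of_real glb_scale"
      using b0 by (simp add: Y w_def)
    show ?thesis
      unfolding same_side_def p K w_def[symmetric] using glb_scale_pos
      by (simp add: zero_less_mult_iff zero_less_divide_iff divide_less_0_iff)
  qed
  have inner: "same_side X Y (X + b * h) K" and outer: "\<not> same_side X Y (X + b * cnj h) K"
    using side unfolding same_side by (simp_all add: mult.commute)
  show "inner_apex K X Y = X + b * h"
    unfolding inner_apex_def
  proof (rule the_equality)
    show "dist (X + b * h) X = 1 \<and> dist (X + b * h) Y = 1 \<and> same_side X Y (X + b * h) K"
      using dists inner by blast
    show "p = X + b * h" if "dist p X = 1 \<and> dist p Y = 1 \<and> same_side X Y p K" for p
      using that dists[of p] outer by auto
  qed
  show "outer_apex K X Y = X + b * cnj h"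
    unfolding outer_apex_def
  proof (rule the_equality)
    show "dist (X + b * cnj h) X = 1 \<and> dist (X + b * cnj h) Y = 1
        \<and> \<not> same_side X Y (X + b * cnj h) K"
      using dists outer by blast
    show "p = X + b * cnj h" if "dist p X = 1 \<and> dist p Y = 1 \<and> \<not> same_side X Y p K" for p
      using that dists[of p] inner by auto
  qed
qed

text \<open>For the rhombus with side vectors \<open>\<lambda>b\<close> and \<open>\<lambda>c\<close> and centre \<open>K\<close>, where \<open>h\<close> turns from \<open>b\<close> towards \<open>c\<close>.
  The first two sides and the side read from \<open>Q\<close> to \<open>S\<close> are traversed with the rhombus on the side of
  \<open>h\<close>; the side read from \<open>M\<close> to \<open>S\<close> is traversed the other way round, hence its outer apex is a turn
  by \<open>h\<close> instead of \<open>cnj h\<close>.\<close>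

lemma rhombus_apexes:
  fixes M b c :: complex
  assumes h: "h \<in> turns" and b: "norm b = 1" and c: "c = b * h ^ n" and n: "0 < n" "n < 10"
  defines "l \<equiv> of_real glb_scale"
  defines "K \<equiv> M + l * (b + c) / 2"
  shows "inner_apex K M (M + l * b) = M + b * h"
    and "inner_apex K (M + l * b) (M + l * b + l * c) = M + l * b + c * h"
    and "outer_apex K M (M + l * c) = M + c * h"
    and "outer_apex K (M + l * b + l * c) (M + l * c) = M + l * b + l * c - b * cnj h"
proof -
  have b0: "b \<noteq> 0"
    using b by auto
  have c1: "norm c = 1"
    using b turn_norm[OF h] by (simp add: c norm_mult norm_power)
  then have c0: "c \<noteq> 0"
    by auto
  have cnj_power: "1 / h ^ n = cnj (h ^ n)"
  proof -
    have "h ^ n * cnj (h ^ n) = 1"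
      using turn_mult_cnj[OF h] by (simp flip: power_mult_distrib)
    then show ?thesis
      by (metis mult_zero_left nonzero_mult_div_cancel_left zero_neq_one)
  qed
  define g where "g = h ^ n"
  have bc: "b / c = cnj g" and cb: "c / b = g"
    using b0 c0 cnj_power by (simp_all add: c g_def)
  have pos: "glb_scale / 2 * (Im g * Im h) > 0"
    using glb_scale_pos Im_turn_power[OF h n] by (simp add: g_def)
  have e: "(K - M) / b = of_real (glb_scale / 2) * (1 + c / b)"
    using b0 by (simp add: K_def l_def field_simps)
  have "Im ((K - M) / b) * Im h > 0"
    unfolding e cb using pos by simp
  then show "inner_apex K M (M + l * b) = M + b * h"
    by (intro apex_eq[OF h b]) (simp_all add: l_def)
  have e: "(K - (M + l * b)) / c = of_real (glb_scale / 2) * (1 - b / c)"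
    using c0 by (simp add: K_def l_def field_simps)
  have "Im ((K - (M + l * b)) / c) * Im h > 0"
    unfolding e bc using pos by simp
  then show "inner_apex K (M + l * b) (M + l * b + l * c) = M + l * b + c * h"
    by (intro apex_eq[OF h c1]) (simp_all add: l_def)
  have e: "(K - M) / c = of_real (glb_scale / 2) * (1 + b / c)"
    using c0 by (simp add: K_def l_def field_simps)
  have "Im ((K - M) / c) * Im (cnj h) > 0"
    unfolding e bc using pos by simp
  then have "outer_apex K M (M + l * c) = M + c * cnj (cnj h)"
    by (intro apex_eq[OF turn_cnj[OF h] c1]) (simp_all add: l_def)
  then show "outer_apex K M (M + l * c) = M + c * h"
    by simp
  have e: "(K - (M + l * b + l * c)) / (- b) = of_real (glb_scale / 2) * (1 + c / b)"
    using b0 by (simp add: K_def l_def field_simps)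
  have "Im ((K - (M + l * b + l * c)) / (- b)) * Im h > 0"
    unfolding e cb using pos by simp
  then have "outer_apex K (M + l * b + l * c) (M + l * c) = M + l * b + l * c + (- b) * cnj h"
    using b by (intro apex_eq[OF h]) (simp_all add: l_def)
  then show "outer_apex K (M + l * b + l * c) (M + l * c) = M + l * b + l * c - b * cnj h"
    by simp
qed


section \<open>The substitution in coordinates\<close>

definition tile_at :: "complex \<Rightarrow> complex \<Rightarrow> complex \<Rightarrow> dtile" where
  "tile_at m b c = (m, m + b, m + b + c, m + c)"

lemma thick_tile_at:
  assumes "h \<in> turns" and "norm b = 1" and "c = b * h ^ 4"
  shows "thick (tile_at m b c)"
  unfolding tile_at_def thick_iff using assms by auto

lemma thin_tile_at:
  assumes "h \<in> turns" and "norm b = 1" and "c = b * h ^ 8"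
  shows "thin (tile_at m b c)"
  unfolding tile_at_def thin_iff using assms by auto

lemma cnj_turn:
  assumes "h \<in> turns"
  shows "cnj h = - (h ^ 9)"
proof -
  have "h \<noteq> 0"
    using turn_norm[OF assms] by auto
  moreover have "h * cnj h = h * - (h ^ 9)"
    using turn_mult_cnj[OF assms] turn_power_10[OF assms] by (simp add: eval_nat_numeral)
  ultimately show ?thesis
    by (metis mult_left_cancel)
qed

text \<open>With \<open>cnj h = - (h ^ 9)\<close>, all edges of the new tiles become \<open>b\<close> times odd powers of \<open>h\<close>. The new tiles
  have the orientation opposite to that of the old one, as the angle from the first to the second
  edge vector is a power of \<open>cnj h\<close>.\<close>

lemma glb_subst_thick:
  assumes h: "h \<in> turns" and b: "norm b = 1"
  defines "c \<equiv> b * h ^ 4" and "l \<equiv> complex_of_real glb_scale"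
  shows "glb_subst (tile_at m b c) =
    {tile_at (l * (m + b)) (b * h ^ 9) (b * h ^ 5),
     tile_at (l * m) (b * h ^ 5) (b * h),
     tile_at (l * (m + b + c)) (b * h ^ 13) (b * h ^ 9),
     tile_at (l * (m + c)) (b * h) (b * h ^ 13)}"
proof -
  define M T Q S
    where "M = l * m" and "T = l * (m + b)" and "Q = l * (m + b + c)" and "S = l * (m + c)"
  have T: "T = M + l * b" and Q: "Q = M + l * b + l * c" and S: "S = M + l * c"
    by (simp_all add: M_def T_def Q_def S_def algebra_simps)
  have l: "l = h - h ^ 9"
    using turn_add_cnj[OF h] cnj_turn[OF h] by (simp add: l_def)
  have lb: "l * b + b * h ^ 9 = b * h" and lc: "l * c + b * h ^ 13 = b * h ^ 5"
    unfolding l c_def by (simp_all add: algebra_simps flip: power_add power_Suc)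
  define K where "K = (M + Q) / 2"
  have K: "K = M + l * (b + c) / 2"
    by (simp add: K_def Q algebra_simps add_divide_distrib)
  have n: "0 < (4 :: nat)" "(4 :: nat) < 10"
    by simp_all
  note apexes = rhombus_apexes[OF h b c_def[THEN meta_eq_to_obj_eq] n, of M, folded l_def, folded K,
      folded S Q, folded T]
  have ch: "c * h = b * h ^ 5"
    by (simp add: c_def eval_nat_numeral)
  have C: "inner_apex K M T = T + b * h ^ 9"
    using apexes(1) lb by (simp add: T)
  have A: "inner_apex K T Q = T + b * h ^ 5"
    using apexes(2) ch by simp
  have E: "outer_apex K M S = M + b * h ^ 5"
    using apexes(3) ch by simp
  have G: "outer_apex K Q S = Q + b * h ^ 9"
    using apexes(4) by (simp add: cnj_turn[OF h])
  have "thick (m, m + b, m + b + c, m + c)"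
    using thick_tile_at[OF h b] by (simp add: tile_at_def c_def)
  then have "glb_subst (tile_at m b c) =
    (let C = inner_apex K M T; A = inner_apex K T Q; E = outer_apex K M S;
         G = outer_apex K Q S; F = A + C - T
     in {(T, C, F, A), (M, E, F, C), (Q, A, F, G), (S, G, F, E)})"
    unfolding tile_at_def
    by (simp only: glb_subst.simps Let_def if_True scaleR_conv_of_real K_def M_def T_def Q_def S_def l_def)
  also have "\<dots> = {tile_at T (b * h ^ 9) (b * h ^ 5), tile_at M (b * h ^ 5) (b * h),
      tile_at Q (b * h ^ 13) (b * h ^ 9), tile_at S (b * h) (b * h ^ 13)}"
  proof -
    have "T + b * h ^ 9 = M + b * h" "T + b * h ^ 5 = Q + b * h ^ 13"
      "Q + b * h ^ 9 = S + b * h" "M + b * h ^ 5 = S + b * h ^ 13"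
      unfolding T Q S lb[symmetric] lc[symmetric] by (simp_all add: algebra_simps)
    then have "(T, T + b * h ^ 9, T + b * h ^ 5 + (T + b * h ^ 9) - T, T + b * h ^ 5)
        = tile_at T (b * h ^ 9) (b * h ^ 5)"
      "(M, M + b * h ^ 5, T + b * h ^ 5 + (T + b * h ^ 9) - T, T + b * h ^ 9)
        = tile_at M (b * h ^ 5) (b * h)"
      "(Q, T + b * h ^ 5, T + b * h ^ 5 + (T + b * h ^ 9) - T, Q + b * h ^ 9)
        = tile_at Q (b * h ^ 13) (b * h ^ 9)"
      "(S, Q + b * h ^ 9, T + b * h ^ 5 + (T + b * h ^ 9) - T, M + b * h ^ 5)
        = tile_at S (b * h) (b * h ^ 13)"
      unfolding tile_at_def prod.inject by algebra+
    then show ?thesis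
      unfolding Let_def C A E G by simp
  qed
  finally show ?thesis
    unfolding M_def T_def Q_def S_def .
qed

lemma glb_subst_thin:
  assumes h: "h \<in> turns" and b: "norm b = 1"
  defines "c \<equiv> b * h ^ 8" and "l \<equiv> complex_of_real glb_scale"
  shows "glb_subst (tile_at m b c) =
    {tile_at (l * (m + c)) (b * h) (b * h ^ 17),
     tile_at (l * m) (b * h ^ 9) (b * h),
     tile_at (l * (m + b + c)) (b * h ^ 17) (b * h ^ 9)}"
proof -
  define M T Q S
    where "M = l * m" and "T = l * (m + b)" and "Q = l * (m + b + c)" and "S = l * (m + c)"
  have T: "T = M + l * b" and Q: "Q = M + l * b + l * c" and S: "S = M + l * c"
    by (simp_all add: M_def T_def Q_def S_def algebra_simps)
  have l: "l = h - h ^ 9"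
    using turn_add_cnj[OF h] cnj_turn[OF h] by (simp add: l_def)
  have lb: "l * b + b * h ^ 9 = b * h" and lc: "l * c + b * h ^ 17 = b * h ^ 9"
    unfolding l c_def by (simp_all add: algebra_simps flip: power_add power_Suc)
  define K where "K = (M + Q) / 2"
  have K: "K = M + l * (b + c) / 2"
    by (simp add: K_def Q algebra_simps add_divide_distrib)
  have n: "0 < (8 :: nat)" "(8 :: nat) < 10"
    by simp_all
  note apexes = rhombus_apexes[OF h b c_def[THEN meta_eq_to_obj_eq] n, of M, folded l_def, folded K,
      folded S Q, folded T]
  have w: "inner_apex K M T = M + b * h"
    using apexes(1) by simp
  have u: "outer_apex K M S = M + b * h ^ 9"
    using apexes(3) by (simp add: c_def eval_nat_numeral)
  have v: "outer_apex K Q S = Q + b * h ^ 9"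
    using apexes(4) by (simp add: cnj_turn[OF h])
  have "thin (m, m + b, m + b + c, m + c)"
    using thin_tile_at[OF h b] by (simp add: tile_at_def c_def)
  moreover have "\<not> thick (m, m + b, m + b + c, m + c)"
    using not_thick_and_thin calculation by blast
  ultimately have "glb_subst (tile_at m b c) =
    (let w = inner_apex K M T; u = outer_apex K M S; v = outer_apex K Q S; x = u + v - S
     in {(S, v, x, u), (M, u, x, w), (Q, w, x, v)})"
    unfolding tile_at_def
    by (simp only: glb_subst.simps Let_def if_True if_False scaleR_conv_of_real
        K_def M_def T_def Q_def S_def l_def)
  also have "\<dots> = {tile_at S (b * h) (b * h ^ 17), tile_at M (b * h ^ 9) (b * h),
      tile_at Q (b * h ^ 17) (b * h ^ 9)}"
  proof -
    have "Q + b * h ^ 9 = S + b * h" "M + b * h ^ 9 = S + b * h ^ 17"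
      "M + b * h = Q + b * h ^ 17"
      unfolding Q S using lb lc by algebra+
    then have "(S, Q + b * h ^ 9, M + b * h ^ 9 + (Q + b * h ^ 9) - S, M + b * h ^ 9)
        = tile_at S (b * h) (b * h ^ 17)"
      "(M, M + b * h ^ 9, M + b * h ^ 9 + (Q + b * h ^ 9) - S, M + b * h)
        = tile_at M (b * h ^ 9) (b * h)"
      "(Q, M + b * h, M + b * h ^ 9 + (Q + b * h ^ 9) - S, Q + b * h ^ 9)
        = tile_at Q (b * h ^ 17) (b * h ^ 9)"
      unfolding tile_at_def prod.inject by algebra+
    then show ?thesis
      unfolding Let_def w u v by simp
  qed
  finally show ?thesis
    unfolding M_def T_def Q_def S_def .
qed

section \<open>The index invariant of substituted patches\<close>

text \<open>Here \<open>p\<close> is the origin and \<open>a\<close> the unit of a similar copy \<open>p + a \<int>[\<zeta>]\<close> of the ring. The edge condition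
  leaves the ten possible units \<open>a \<zeta> ^ i\<close> on an equal footing, which is harmless as they change indices
  only by a sign.\<close>

fun marked_in :: "complex \<Rightarrow> complex \<Rightarrow> dtile \<Rightarrow> bool" where
  "marked_in p a (m, t, q, s) \<longleftrightarrow> (thick (m, t, q, s) \<or> thin (m, t, q, s)) \<and>
     (m - p) / a \<in> index_class 0 \<and> ((t - m) / a) ^ 10 = 1"

lemma thick_or_thinE:
  assumes "thick (m, t, q, s) \<or> thin (m, t, q, s)"
  obtains h n where "h \<in> turns" and "n \<in> {2, 4}" and "s - m = (t - m) * h ^ (2 * n)"
    and "norm (t - m) = 1" and "q = t + s - m"
proof -
  from assms show thesis
  proof
    assume "thick (m, t, q, s)"
    then obtain h where "h \<in> turns" "s - m = (t - m) * h ^ (2 * 2)"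
      "norm (t - m) = 1" "q = t + s - m"
      unfolding thick_iff by auto
    then show thesis
      by (intro that[of h 2]) auto
  next
    assume "thin (m, t, q, s)"
    then obtain h where "h \<in> turns" "s - m = (t - m) * h ^ (2 * 4)"
      "norm (t - m) = 1" "q = t + s - m"
      unfolding thin_iff by auto
    then show thesis
      by (intro that[of h 4]) auto
  qed
qed

text \<open>The edge from \<open>m\<close> to \<open>t\<close> is a tenth root of unity times \<open>a\<close>, so its index is \<open>e\<close> with \<open>e = 1\<close> or
  \<open>e = -1\<close>, and the edge from \<open>m\<close> to \<open>s\<close> arises from it by an even power of \<open>\<zeta>\<close>.\<close>

lemma marked_in_indices:
  assumes "marked_in p a (m, t, q, s)"
  obtains e where "e \<in> {1, -1}" and "(m - p) / a \<in> index_class 0"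
    and "(t - p) / a \<in> index_class e" and "(s - p) / a \<in> index_class e"
    and "(q - p) / a \<in> index_class (2 * e)"
proof -
  have m: "(m - p) / a \<in> index_class 0" and root: "((t - m) / a) ^ 10 = 1"
    and "thick (m, t, q, s) \<or> thin (m, t, q, s)"
    using assms by auto
  then obtain h n where h: "h \<in> turns" and n: "n \<in> {2, 4}"
    and s: "s - m = (t - m) * h ^ (2 * n)" and q: "q = t + s - m"
    by (elim thick_or_thinE) auto
  obtain e where e: "e \<in> {1, -1}" "(t - m) / a \<in> index_class e"
    using tenth_root_of_unity_index[OF root] by blast
  obtain k where "h ^ (2 * n) = zeta ^ (k * n)"
    using turn_power_eq_zeta_power[OF h] by metis
  then have "(s - m) / a = zeta ^ (k * n) * ((t - m) / a)"
    by (simp add: s)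
  then have sm: "(s - m) / a \<in> index_class e"
    using index_class_zeta_power_mult[OF e(2), of "k * n"] n by auto
  have t: "(t - p) / a \<in> index_class e"
    using index_class_add[OF m e(2)] by (simp flip: add_divide_distrib)
  have "(s - p) / a \<in> index_class e"
    using index_class_add[OF m sm] by (simp flip: add_divide_distrib)
  moreover have "(q - p) / a \<in> index_class (2 * e)"
    using index_class_add[OF t sm] by (simp add: q flip: add_divide_distrib) (simp add: algebra_simps)
  ultimately show thesis
    using e m t that by blast
qed

text \<open>Any vertex \<open>v\<close> of the old tile, whatever its index \<open>i\<close>, may become the marked corner of a new tile, since
  scaling moves it into the class of index \<open>0\<close>. The new edges are odd powers of \<open>h\<close>, whose
  tenth powers are \<open>-1\<close>, matching the tenth power of \<open>\<eta>\<close> in the new unit.\<close>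

lemma marked_in_scaled_corner:
  assumes v: "(v - p) / a \<in> index_class i" and root: "(b / a) ^ 10 = 1"
    and h: "h \<in> turns" and b: "norm b = 1"
    and k: "odd k" and kj: "h ^ k = h ^ j * h ^ 4 \<or> h ^ k = h ^ j * h ^ 8"
  shows "marked_in (of_real glb_scale * p) (eta * a)
    (tile_at (of_real glb_scale * v) (b * h ^ k) (b * h ^ j))"
proof -
  have "(h ^ k) ^ 10 = (h ^ 10) ^ k"
    by (simp add: mult.commute flip: power_mult)
  then have "(h ^ k) ^ 10 = -1"
    using h k by (simp add: turn_power_10)
  then have "(b * h ^ k / (eta * a)) ^ 10 = 1"
    using root eta_power_10 by (simp add: power_divide power_mult_distrib)
  moreover have "(of_real glb_scale * v - of_real glb_scale * p) / (eta * a)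
      = of_real glb_scale * ((v - p) / a) / eta"
    by (simp add: algebra_simps)
  moreover have "thick (tile_at w (b * h ^ k) (b * h ^ j)) \<or> thin (tile_at w (b * h ^ k) (b * h ^ j))"
    for w
  proof -
    have norm: "norm (b * h ^ k) = 1"
      using b turn_norm[OF h] by (simp add: norm_mult norm_power)
    have reversed: "b * h ^ j = b * h ^ k * cnj h ^ n" if "h ^ k = h ^ j * h ^ n" for n
    proof -
      have "h ^ n * cnj h ^ n = 1"
        using turn_mult_cnj[OF h] by (simp flip: power_mult_distrib)
      then show ?thesis
        by (simp add: that mult.assoc)
    qed
    from kj show ?thesis
    proof
      assume "h ^ k = h ^ j * h ^ 4"
      then show ?thesis
        using thick_tile_at[OF turn_cnj[OF h] norm reversed] by blast
    next
      assume "h ^ k = h ^ j * h ^ 8"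
      then show ?thesis
        using thin_tile_at[OF turn_cnj[OF h] norm reversed] by blast
    qed
  qed
  ultimately show ?thesis
    using index_class_scale[OF v] by (simp add: tile_at_def)
qed

lemma marked_in_glb_subst:
  assumes "marked_in p a d" and "d' \<in> glb_subst d"
  shows "marked_in (of_real glb_scale * p) (eta * a) d'"
proof -
  obtain m t q s where d: "d = (m, t, q, s)"
    by (cases d)
  define b where "b = t - m"
  have root: "(b / a) ^ 10 = 1" and tt: "thick (m, t, q, s) \<or> thin (m, t, q, s)"
    using assms(1) by (auto simp: d b_def)
  obtain e where m: "(m - p) / a \<in> index_class 0" and t: "(t - p) / a \<in> index_class e"
    and s: "(s - p) / a \<in> index_class e" and q: "(q - p) / a \<in> index_class (2 * e)"
    using assms(1) unfolding d by (elim marked_in_indices)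
  from tt show ?thesis
  proof
    assume "thick (m, t, q, s)"
    then obtain h where h: "h \<in> turns" and sh: "s - m = b * h ^ 4"
      and b: "norm b = 1" and qs: "q = t + s - m"
      unfolding thick_iff b_def by auto
    have ts: "t = m + b" "s = m + b * h ^ 4"
      using sh by (simp_all add: b_def diff_eq_eq add.commute)
    have vs: "q = m + b + b * h ^ 4"
      using qs by (simp add: ts)
    have "d = tile_at m b (b * h ^ 4)"
      by (simp add: d tile_at_def ts vs)
    then have d': "d' \<in> {tile_at (of_real glb_scale * t) (b * h ^ 9) (b * h ^ 5),
        tile_at (of_real glb_scale * m) (b * h ^ 5) (b * h ^ 1),
        tile_at (of_real glb_scale * q) (b * h ^ 13) (b * h ^ 9),
        tile_at (of_real glb_scale * s) (b * h ^ 1) (b * h ^ 13)}"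
      using assms(2) glb_subst_thick[OF h b, of m] by (simp add: ts vs)
    have powers: "h ^ 9 = h ^ 5 * h ^ 4" "h ^ 5 = h ^ 1 * h ^ 4" "h ^ 13 = h ^ 9 * h ^ 4"
      by (simp_all flip: power_add power_Suc)
    \<comment> \<open>The thin new tile needs a full turn, \<open>h ^ 20 = 1\<close>.\<close>
    have power: "h ^ 1 = h ^ 13 * h ^ 8"
      using turn_power_add_10[OF h, of 1] turn_power_add_10[OF h, of 11]
      by (simp flip: power_add)
    note corner = marked_in_scaled_corner[OF _ root h b]
    show ?thesis
      using d' corner[OF t _ disjI1, OF _ powers(1)] corner[OF m _ disjI1, OF _ powers(2)]
        corner[OF q _ disjI1, OF _ powers(3)] corner[OF s _ disjI2, OF _ power]
      by force
  next
    assume "thin (m, t, q, s)"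
    then obtain h where h: "h \<in> turns" and sh: "s - m = b * h ^ 8"
      and b: "norm b = 1" and qs: "q = t + s - m"
      unfolding thin_iff b_def by auto
    have ts: "t = m + b" "s = m + b * h ^ 8"
      using sh by (simp_all add: b_def diff_eq_eq add.commute)
    have vs: "q = m + b + b * h ^ 8"
      using qs by (simp add: ts)
    have "d = tile_at m b (b * h ^ 8)"
      by (simp add: d tile_at_def ts vs)
    then have d': "d' \<in> {tile_at (of_real glb_scale * s) (b * h ^ 1) (b * h ^ 17),
        tile_at (of_real glb_scale * m) (b * h ^ 9) (b * h ^ 1),
        tile_at (of_real glb_scale * q) (b * h ^ 17) (b * h ^ 9)}"
      using assms(2) glb_subst_thin[OF h b, of m] by (simp add: ts vs)
    have powers: "h ^ 9 = h ^ 1 * h ^ 8" "h ^ 17 = h ^ 9 * h ^ 8"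
      by (simp_all flip: power_add power_Suc)
    \<comment> \<open>The thick new tile needs a full turn, \<open>h ^ 20 = 1\<close>.\<close>
    have power: "h ^ 1 = h ^ 17 * h ^ 4"
      using turn_power_add_10[OF h, of 1] turn_power_add_10[OF h, of 11]
      by (simp flip: power_add)
    note corner = marked_in_scaled_corner[OF _ root h b]
    show ?thesis
      using d' corner[OF s _ disjI1, OF _ power] corner[OF m _ disjI2, OF _ powers(1)]
        corner[OF q _ disjI2, OF _ powers(2)]
      by force
  qed
qed

lemma marked_in_translate:
  assumes "marked_in p a (z + m, z + t, z + q, z + s)"
  shows "marked_in (p - z) a (m, t, q, s)"
proof -
  have "unit_rhombus (z + m, z + t, z + q, z + s) \<longleftrightarrow> unit_rhombus (m, t, q, s)"
    by (auto simp: algebra_simps)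
  then have "thick (z + m, z + t, z + q, z + s) \<longleftrightarrow> thick (m, t, q, s)"
    and "thin (z + m, z + t, z + q, z + s) \<longleftrightarrow> thin (m, t, q, s)"
    by (simp_all add: corner_angle_def)
  then show ?thesis
    using assms by (simp add: algebra_simps)
qed

text \<open>The initial tile is marked with respect to its own marked corner and first edge; each substitution step
  then scales the origin and turns the unit.\<close>

lemma glb_patch_marked:
  assumes "thick P \<or> thin P"
  shows "\<exists>p a. a \<noteq> 0 \<and> (\<forall>d\<in>(glb_subst_set ^^ k) {P}. marked_in p a d)"
proof (induction k)
  case 0
  obtain m t q s where P: "P = (m, t, q, s)"
    by (cases P)
  then have "t \<noteq> m"
    using assms by auto
  then have "t - m \<noteq> 0 \<and> marked_in m (t - m) P"
    using assms zero_in_index_class by (auto simp: P)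
  then show ?case
    by (intro exI[of _ m] exI[of _ "t - m"]) simp
next
  case (Suc k)
  then obtain p a where "a \<noteq> 0" and "\<forall>d\<in>(glb_subst_set ^^ k) {P}. marked_in p a d"
    by blast
  then have "eta * a \<noteq> 0 \<and>
      (\<forall>d\<in>(glb_subst_set ^^ Suc k) {P}. marked_in (of_real glb_scale * p) (eta * a) d)"
    using eta_nonzero marked_in_glb_subst by (auto simp: glb_subst_set_def)
  then show ?case
    by blast
qed

text \<open>The origin may be moved to any marked corner, since it has index \<open>0\<close>, and the unit may be replaced by
  the edge of any marked tile, since units differ by tenth roots of unity. This leaves only finitely many
  origins and units to consider once a tile is fixed.\<close>

lemma marked_in_rebase:
  assumes "a \<noteq> 0" and "marked_in p a (m, t, q, s)" and "marked_in p a (m', t', q', s')"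
  shows "marked_in m (t - m) (m', t', q', s')"
proof -
  define z where "z = (t - m) / a"
  have z: "z ^ 10 = 1"
    using assms(2) by (simp add: z_def)
  then have "z \<noteq> 0"
    by auto
  then have a: "a = (t - m) / z" and "t \<noteq> m"
    using assms(1) by (auto simp: z_def field_simps)
  have inverse: "(1 / z) ^ 10 = 1"
    using z by (simp add: power_divide)
  have "(m' - m) / a = (m' - p) / a - (m - p) / a"
    by (simp flip: diff_divide_distrib)
  then have "(m' - m) / a \<in> index_class 0"
    using index_class_diff[of _ 0 _ 0] assms(2,3) by simp
  then have "1 / z * ((m' - m) / a) \<in> index_class 0"
    using inverse by (rule index_class_zero_root_mult)
  then have "(m' - m) / (t - m) \<in> index_class 0"
    using \<open>z \<noteq> 0\<close> by (simp add: a)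
  moreover have "(t' - m') / (t - m) = 1 / z * ((t' - m') / a)"
    using \<open>z \<noteq> 0\<close> by (simp add: a)
  then have "((t' - m') / (t - m)) ^ 10 = 1"
    using inverse assms(3) unfolding \<open>(t' - m') / (t - m) = _\<close> power_mult_distrib by simp
  ultimately show ?thesis
    using assms(3) by simp
qed

section \<open>Recovering the corners from the region\<close>

text \<open>The line through \<open>m\<close> perpendicular to the diagonal from \<open>m\<close> to \<open>q\<close> separates \<open>m\<close> from the other
  three corners.\<close>

lemma rhomb_corner_extreme:
  assumes "m + q = t + s" and "dist m t = dist m s" and "m \<noteq> q"
  shows "m extreme_point_of rhomb (m, t, q, s)"
proof -
  define u v where "u = t - m" and "v = s - m"
  have "q - m = (t - m) + (s - m)"
    using assms(1) by (simp add: algebra_simps)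
  then have vs: "t = m + u" "s = m + v" "q = m + (u + v)"
    by (simp_all add: u_def v_def diff_eq_eq)
  have eq: "u \<bullet> u = v \<bullet> v"
    using assms(2) by (simp add: u_def v_def dist_norm norm_minus_commute flip: norm_eq)
  have pos: "(u + v) \<bullet> (u + v) > 0"
    using assms(3) vs(3) by (metis add.right_neutral inner_gt_zero_iff)
  have "(u + v) \<bullet> u > 0" "(u + v) \<bullet> v > 0"
    using pos eq by (simp_all add: inner_add inner_commute)
  then have "{t, q, s} \<subseteq> {x. (u + v) \<bullet> x > (u + v) \<bullet> m}"
    using pos by (simp add: vs inner_add_right)
  then have "convex hull {t, q, s} \<subseteq> {x. (u + v) \<bullet> x > (u + v) \<bullet> m}"
    by (intro hull_minimal convex_halfspace_gt)
  then have "m \<notin> convex hull {t, q, s}"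
    by auto
  then show ?thesis
    by (auto intro: extreme_point_of_convex_hull_insert)
qed

lemma extreme_points_rhomb:
  assumes "unit_rhombus (m, t, q, s)" and "m \<noteq> q" and "t \<noteq> s"
  shows "{x. x extreme_point_of rhomb (m, t, q, s)} = {m, t, q, s}"
proof
  show "{x. x extreme_point_of rhomb (m, t, q, s)} \<subseteq> {m, t, q, s}"
    using extreme_point_of_convex_hull by fastforce
  have "m + q = t + s" "norm (t - m) = 1" "norm (s - m) = 1"
    using assms(1) by (auto simp: dist_norm norm_minus_commute)
  moreover from this have "q - t = s - m" "q - s = t - m"
    by (simp_all add: algebra_simps)
  ultimately have "m extreme_point_of rhomb (m, t, q, s)" "q extreme_point_of rhomb (q, t, m, s)"
    "t extreme_point_of rhomb (t, m, s, q)" "s extreme_point_of rhomb (s, m, t, q)"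
    using assms(2,3)
    by (auto intro!: rhomb_corner_extreme simp: dist_norm norm_minus_commute add.commute
        simp del: rhomb.simps)
  moreover have "rhomb (q, t, m, s) = rhomb (m, t, q, s)" "rhomb (t, m, s, q) = rhomb (m, t, q, s)"
    "rhomb (s, m, t, q) = rhomb (m, t, q, s)"
    by (simp_all add: insert_commute)
  ultimately show "{m, t, q, s} \<subseteq> {x. x extreme_point_of rhomb (m, t, q, s)}"
    by (simp del: rhomb.simps)
qed

text \<open>In units of the side, the squared diagonals are \<open>2 + 2 cos \<alpha>\<close> and \<open>2 - 2 cos \<alpha>\<close> for the angle \<open>\<alpha>\<close> at
  the marked corner; the cosines of \<open>72\<close> and \<open>144\<close> degrees are expressed through that of \<open>36\<close>
  degrees.\<close>

lemma diagonals:
  assumes "thick (m, t, q, s) \<or> thin (m, t, q, s)"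
  shows "dist m q ^ 2 \<in> {1 + 2 * cos (pi / 5), 2 - 2 * cos (pi / 5)}"
    and "dist t s ^ 2 \<in> {3 - 2 * cos (pi / 5), 2 + 2 * cos (pi / 5)}"
proof -
  have dists: "dist m q ^ 2 = 2 + 2 * Re w \<and> dist t s ^ 2 = 2 - 2 * Re w"
    if "norm (t - m) = 1" "q = t + s - m" "s - m = (t - m) * w" "norm w = 1" for w
  proof -
    have "q - m = (t - m) + (s - m)" "s - t = (s - m) - (t - m)"
      by (simp_all add: that(2))
    then have "q - m = (t - m) * (1 + w)" "s - t = (t - m) * (w - 1)"
      unfolding that(3) by (simp_all add: algebra_simps)
    then have "dist m q = norm (1 + w)" "dist t s = norm (w - 1)"
      using that(1) by (metis dist_commute dist_norm norm_mult mult_1)+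
    moreover have "(Re w) ^ 2 + (Im w) ^ 2 = 1"
      using that(4) by (simp add: cmod_def)
    ultimately show ?thesis
      by (simp add: cmod_power2) (simp add: power2_eq_square algebra_simps)
  qed
  have re4: "Re (h ^ 4) = cos (pi / 5) - 1 / 2" if "h \<in> turns" for h
  proof -
    have "Re (h ^ 4) = cos (2 * (pi / 5))"
      using that unfolding turns_def eta_def by (auto simp: cis_cnj Complex.DeMoivre)
    also have "\<dots> = cos (pi / 5) - 1 / 2"
      unfolding cos_double_cos using cos_36_quadratic by simp
    finally show ?thesis .
  qed
  have re8: "Re (h ^ 8) = - cos (pi / 5)" if "h \<in> turns" for h
  proof -
    have "Re (h ^ 8) = cos (pi - pi / 5)"
      using that unfolding turns_def eta_def by (auto simp: cis_cnj Complex.DeMoivre)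
    then show ?thesis
      by (simp only: cos_pi_minus)
  qed
  from assms have "(\<exists>h\<in>turns. dist m q ^ 2 = 2 + 2 * Re (h ^ 4) \<and> dist t s ^ 2 = 2 - 2 * Re (h ^ 4)) \<or>
      (\<exists>h\<in>turns. dist m q ^ 2 = 2 + 2 * Re (h ^ 8) \<and> dist t s ^ 2 = 2 - 2 * Re (h ^ 8))"
    unfolding thick_iff thin_iff using dists turn_norm by (metis norm_power power_one)
  then show "dist m q ^ 2 \<in> {1 + 2 * cos (pi / 5), 2 - 2 * cos (pi / 5)}"
    and "dist t s ^ 2 \<in> {3 - 2 * cos (pi / 5), 2 + 2 * cos (pi / 5)}"
    using re4 re8 by auto
qed

lemma diagonals_distinct:
  assumes "thick (m, t, q, s) \<or> thin (m, t, q, s)" and "thick (m', t', q', s') \<or> thin (m', t', q', s')"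
  shows "dist m q \<noteq> dist t' s'" and "m \<noteq> q" and "t \<noteq> s"
proof -
  define c where "c = cos (pi / 5)"
  have quadratic: "4 * c ^ 2 - 2 * c = 1"
    using cos_36_quadratic by (simp add: c_def)
  have pos: "c > 0"
    unfolding c_def by (intro cos_gt_zero_pi) (use pi_gt_zero in linarith)+
  have c: "c \<noteq> 1 / 2" "c \<noteq> 1" "c \<noteq> 3 / 2"
  proof -
    have "4 * x ^ 2 - 2 * x = 1" if "c = x" for x
      using quadratic that by simp
    from this[of "1 / 2"] this[of 1] this[of "3 / 2"] show "c \<noteq> 1 / 2" "c \<noteq> 1" "c \<noteq> 3 / 2"
      by (auto simp: power2_eq_square)
  qed
  note d = diagonals[OF assms(1), folded c_def] and d' = diagonals[OF assms(2), folded c_def]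
  show "dist m q \<noteq> dist t' s'"
    using d(1) d'(2) c pos by auto
  show "m \<noteq> q"
    using d(1) c pos by auto
  show "t \<noteq> s"
    using d(2) c pos by auto
qed

text \<open>The region determines its set of corners. Both pairs of opposite corners have half the sum of all
  corners as their sum, which leaves only a possible exchange of the two diagonals, and their
  lengths exclude it.\<close>

lemma rhomb_determines_diagonals:
  assumes d: "thick (m, t, q, s) \<or> thin (m, t, q, s)"
    and d': "thick (m', t', q', s') \<or> thin (m', t', q', s')"
    and eq: "rhomb (m, t, q, s) = rhomb (m', t', q', s')"
  shows "{m, q} = {m', q'}" and "{t, s} = {t', s'}"
proof -
  have u: "unit_rhombus (m, t, q, s)" and u': "unit_rhombus (m', t', q', s')"
    using d d' by auto
  have ne: "m \<noteq> q" "t \<noteq> s" "m' \<noteq> q'" "t' \<noteq> s'" "dist t s \<noteq> dist m' q'"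
    using diagonals_distinct[OF d d'] diagonals_distinct[OF d' d] by auto
  have same: "{m, t, q, s} = {m', t', q', s'}"
    using eq extreme_points_rhomb[OF u] extreme_points_rhomb[OF u'] ne by metis
  have sides: "m \<noteq> t" "m \<noteq> s" "q \<noteq> t" "q \<noteq> s" "m' \<noteq> t'" "m' \<noteq> s'" "q' \<noteq> t'" "q' \<noteq> s'"
    using u u' ne by (auto simp: dist_norm)
  have sum: "m + q = t + s" and sum': "m' + q' = t' + s'"
    using u u' by auto
  have "(\<Sum>x\<in>{m, t, q, s}. x) = 2 * (m + q)" "(\<Sum>x\<in>{m', t', q', s'}. x) = 2 * (m' + q')"
    using ne sides sum sum' by simp_all
  then have "2 * (m' + q') = 2 * (m + q)"
    using same by metis
  then have sums: "m' + q' = m + q"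
    by (simp only: mult_cancel_left) simp
  have "m' \<in> {m, t, q, s}"
    using same by blast
  moreover have "q' = s" if "m' = t"
    using that sums sum by simp
  moreover have "q' = t" if "m' = s"
    using that sums sum by (simp add: add.commute)
  ultimately have "m' = m \<or> m' = q"
    using ne(5) by (auto simp: dist_commute)
  then show mq: "{m, q} = {m', q'}"
    using sums by (auto simp: add.commute)
  show "{t, s} = {t', s'}"
  proof -
    have "{m, t, q, s} - {m, q} = {t, s}" "{m', t', q', s'} - {m', q'} = {t', s'}"
      using sides by auto
    then show ?thesis
      using same mq by simp
  qed
qed

section \<open>From patches to the tiling\<close>

text \<open>Finite patches are marked for some origin and unit depending on the patch. Fix a tile \<open>R0\<close>. If each of
  the four ways to choose a marked corner and an edge of \<open>R0\<close> failed at some tile of the tiling, then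
  the patch of \<open>R0\<close> and these four tiles could not be marked, because after rebasing to the marked
  corner of \<open>R0\<close> one of the four ways would succeed on it.\<close>

lemma glb_tiling_marked:
  assumes "glb_tiling \<T>"
  shows "\<exists>p a. a \<noteq> 0 \<and> (\<forall>R\<in>\<T>. \<exists>d. marked_in p a d \<and> rhomb d = R)"
proof -
  have tiles: "\<forall>R\<in>\<T>. \<exists>d. (thick d \<or> thin d) \<and> R = rhomb d"
    using assms unfolding glb_tiling_def rhombus_tiling_def by (elim conjE)
  obtain P where P: "thick P \<or> thin P" and patches:
    "\<forall>\<F>. finite \<F> \<and> \<F> \<subseteq> \<T> \<longrightarrow>
       (\<exists>k\<ge>1. \<exists>z. (\<lambda>R. (\<lambda>x. z + x) ` R) ` \<F> \<subseteq> rhomb ` ((glb_subst_set ^^ k) {P}))"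
    using assms unfolding glb_tiling_def by (elim conjE exE)
  have patch: "\<exists>p a. a \<noteq> 0 \<and> (\<forall>R\<in>\<F>. \<exists>d. marked_in p a d \<and> rhomb d = R)"
    if F: "finite \<F>" "\<F> \<subseteq> \<T>" for \<F>
  proof -
    obtain k z where kz: "(\<lambda>R. (\<lambda>x. z + x) ` R) ` \<F> \<subseteq> rhomb ` ((glb_subst_set ^^ k) {P})"
      using patches F by meson
    obtain p a where a: "a \<noteq> 0" and marked: "\<forall>d\<in>(glb_subst_set ^^ k) {P}. marked_in p a d"
      using glb_patch_marked[OF P] by meson
    have "\<exists>d. marked_in (p - z) a d \<and> rhomb d = R" if "R \<in> \<F>" for R
    proof -
      have "(\<lambda>x. z + x) ` R \<in> rhomb ` ((glb_subst_set ^^ k) {P})"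
        using kz that by (rule subsetD[OF _ imageI])
      then obtain d where R: "(\<lambda>x. z + x) ` R = rhomb d" and d_in: "d \<in> (glb_subst_set ^^ k) {P}"
        by (rule imageE)
      have "marked_in p a d"
        using marked d_in by (rule bspec)
      obtain m' t' q' s' where "d = (m', t', q', s')"
        by (cases d)
      then obtain m t q s where d: "d = (z + m, z + t, z + q, z + s)"
        by (intro that[of "m' - z" "t' - z" "q' - z" "s' - z"]) simp
      have "marked_in (p - z) a (m, t, q, s)"
        using \<open>marked_in p a d\<close> unfolding d by (rule marked_in_translate)
      have "rhomb d = (\<lambda>x. z + x) ` rhomb (m, t, q, s)"
        by (simp only: d rhomb.simps image_insert image_empty flip: convex_hull_translation)
      then have "rhomb (m, t, q, s) = R"
        using R inj_image_eq_iff[of "\<lambda>x. z + x"] by (simp add: inj_on_def)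
      then show ?thesis
        using \<open>marked_in (p - z) a (m, t, q, s)\<close> by blast
    qed
    then show ?thesis
      using a by blast
  qed
  have "\<Union>\<T> = UNIV"
    using assms by (simp add: glb_tiling_def rhombus_tiling_def)
  then obtain R0 where R0: "R0 \<in> \<T>"
    by blast
  then obtain d0 where tile0: "(thick d0 \<or> thin d0) \<and> R0 = rhomb d0"
    using tiles by blast
  obtain m0 t0 q0 s0 where "d0 = (m0, t0, q0, s0)"
    by (cases d0)
  then have d0: "thick (m0, t0, q0, s0) \<or> thin (m0, t0, q0, s0)"
    and R0_eq: "R0 = rhomb (m0, t0, q0, s0)"
    using tile0 by blast+
  define good where "good x y R \<longleftrightarrow> (\<exists>d. marked_in x (y - x) d \<and> rhomb d = R)" for x y R
  have "\<exists>x\<in>{m0, q0}. \<exists>y\<in>{t0, s0}. \<forall>R\<in>\<T>. good x y R"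
  proof (rule ccontr)
    assume "\<not> ?thesis"
    then have "\<forall>x\<in>{m0, q0}. \<forall>y\<in>{t0, s0}. \<exists>R\<in>\<T>. \<not> good x y R"
      by blast
    then obtain r where r: "\<And>x y. x \<in> {m0, q0} \<Longrightarrow> y \<in> {t0, s0} \<Longrightarrow> r x y \<in> \<T> \<and> \<not> good x y (r x y)"
      by metis
    define \<F> where "\<F> = insert R0 (case_prod r ` ({m0, q0} \<times> {t0, s0}))"
    have "finite \<F>" "\<F> \<subseteq> \<T>"
      using r R0 by (auto simp: \<F>_def)
    then obtain p a where a: "a \<noteq> 0" and F: "\<forall>R\<in>\<F>. \<exists>d. marked_in p a d \<and> rhomb d = R"
      using patch by blast
    have "R0 \<in> \<F>"
      by (simp add: \<F>_def)
    then obtain d where "marked_in p a d" "rhomb d = R0"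
      using F by blast
    then obtain m t q s where d: "marked_in p a (m, t, q, s)" "rhomb (m, t, q, s) = R0"
      by (cases d) blast
    have "{m0, q0} = {m, q}" "{t0, s0} = {t, s}"
      using rhomb_determines_diagonals[OF d0, of m t q s] d R0_eq by auto
    then have mt: "m \<in> {m0, q0}" "t \<in> {t0, s0}"
      by auto
    then have "r m t \<in> \<F>"
      unfolding \<F>_def by (intro insertI2 image_eqI[of _ _ "(m, t)"]) auto
    then obtain d' where d': "marked_in p a d'" "rhomb d' = r m t"
      using F by blast
    then have "marked_in m (t - m) d'"
      using marked_in_rebase[OF a d(1)] by (cases d') blast
    then have "good m t (r m t)"
      using d'(2) unfolding good_def by blast
    then show False
      using r mt by blast
  qed
  then obtain x y where "x \<in> {m0, q0}" "y \<in> {t0, s0}" and all: "\<forall>R\<in>\<T>. good x y R"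
    by blast
  moreover have "m0 \<noteq> t0" "m0 \<noteq> s0" "q0 \<noteq> t0" "q0 \<noteq> s0"
    using d0 by (auto simp: dist_norm)
  ultimately have "y - x \<noteq> 0"
    by auto
  then show ?thesis
    using all unfolding good_def by blast
qed

section \<open>The frieze patterns\<close>

text \<open>On the vertices of marked tiles the last case means that the index is \<open>2\<close> or \<open>-2\<close>.\<close>

definition index_frieze :: "complex \<Rightarrow> complex \<Rightarrow> complex set \<Rightarrow> int \<Rightarrow> complex \<Rightarrow> int" where
  "index_frieze p a V n = (\<lambda>x\<in>V.
     if (x - p) / a \<in> index_class 0 then n
     else if (x - p) / a \<in> index_class 1 \<union> index_class (-1) then n + 1
     else n + 2)"

lemma index_frieze_marked_tile:
  assumes "marked_in p a (m, t, q, s)" and "{m, t, q, s} \<subseteq> V"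
  shows "index_frieze p a V n m = n" and "index_frieze p a V n t = n + 1"
    and "index_frieze p a V n s = n + 1" and "index_frieze p a V n q = n + 2"
proof -
  obtain e where e: "e \<in> {1, -1}" and m: "(m - p) / a \<in> index_class 0"
    and t: "(t - p) / a \<in> index_class e" and s: "(s - p) / a \<in> index_class e"
    and q: "(q - p) / a \<in> index_class (2 * e)"
    using assms(1) by (elim marked_in_indices)
  show "index_frieze p a V n m = n"
    using m assms(2) by (simp add: index_frieze_def)
  have "(t - p) / a \<notin> index_class 0" "(s - p) / a \<notin> index_class 0"
    using e index_class_unique[OF t, of 0] index_class_unique[OF s, of 0] by auto
  then show "index_frieze p a V n t = n + 1" "index_frieze p a V n s = n + 1"
    using e t s assms(2) by (auto simp: index_frieze_def)
  have "(q - p) / a \<notin> index_class 0" "(q - p) / a \<notin> index_class 1" "(q - p) / a \<notin> index_class (-1)"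
    using e index_class_unique[OF q, of 0] index_class_unique[OF q, of 1]
      index_class_unique[OF q, of "-1"] by auto
  then show "index_frieze p a V n q = n + 2"
    using assms(2) by (simp add: index_frieze_def)
qed

lemma rhomb_corners_subset_vertices:
  assumes "thick (m, t, q, s) \<or> thin (m, t, q, s)" and "rhomb (m, t, q, s) \<in> \<T>"
  shows "{m, t, q, s} \<subseteq> vertices \<T>"
proof -
  have "unit_rhombus (m, t, q, s)"
    using assms(1) by auto
  then have "{x. x extreme_point_of rhomb (m, t, q, s)} = {m, t, q, s}"
    using diagonals_distinct[OF assms(1) assms(1)] by (intro extreme_points_rhomb)
  then show ?thesis
    using assms(2) unfolding vertices_def by blast
qed

lemma frieze_pattern_index_frieze:
  assumes marked: "\<And>R. R \<in> \<T> \<Longrightarrow> \<exists>d. marked_in p a d \<and> rhomb d = R" and n: "n > 0"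
  shows "frieze_pattern \<T> (index_frieze p a (vertices \<T>) n)"
  unfolding frieze_pattern_def
proof (intro conjI allI impI)
  show "index_frieze p a (vertices \<T>) n \<in> vertices \<T> \<rightarrow>\<^sub>E {0<..}"
    using n by (auto simp: index_frieze_def)
  fix m t q s
  let ?f = "index_frieze p a (vertices \<T>) n"
  assume d: "(thick (m, t, q, s) \<or> thin (m, t, q, s)) \<and> rhomb (m, t, q, s) \<in> \<T>"
  then obtain m' t' q' s' where d': "marked_in p a (m', t', q', s')"
    and eq: "rhomb (m, t, q, s) = rhomb (m', t', q', s')"
    using marked by (metis prod_cases4)
  have tile': "thick (m', t', q', s') \<or> thin (m', t', q', s')"
    using d' by simp
  have "{m', t', q', s'} \<subseteq> vertices \<T>"
    using rhomb_corners_subset_vertices[OF tile'] d eq by metis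
  note corner_values = index_frieze_marked_tile[OF d' this, of n]
  have "{m, q} = {m', q'}" "{t, s} = {t', s'}"
    using rhomb_determines_diagonals[OF _ tile' eq] d by auto
  then have "?f m * ?f q = n * (n + 2)" "?f t * ?f s = (n + 1) * (n + 1)"
    using corner_values by (auto simp: doubleton_eq_iff)
  then show "?f t * ?f s - ?f m * ?f q = 1"
    by (simp add: algebra_simps)
qed

lemma index_frieze_image:
  assumes marked: "\<And>R. R \<in> \<T> \<Longrightarrow> \<exists>d. marked_in p a d \<and> rhomb d = R" and "\<T> \<noteq> {}"
  shows "index_frieze p a (vertices \<T>) n ` vertices \<T> = {n, n + 1, n + 2}"
proof
  show "index_frieze p a (vertices \<T>) n ` vertices \<T> \<subseteq> {n, n + 1, n + 2}"
    by (auto simp: index_frieze_def)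
  obtain R m t q s where "R \<in> \<T>" and d: "marked_in p a (m, t, q, s)" "rhomb (m, t, q, s) = R"
    using assms by (metis all_not_in_conv prod_cases4)
  then have "{m, t, q, s} \<subseteq> vertices \<T>"
    by (intro rhomb_corners_subset_vertices) auto
  then show "{n, n + 1, n + 2} \<subseteq> index_frieze p a (vertices \<T>) n ` vertices \<T>"
    using index_frieze_marked_tile[OF d(1), of "vertices \<T>" n] by (metis image_eqI insert_subset empty_subsetI)
qed

theorem corollary3p2:
  fixes \<T> :: "complex set set"
  assumes "glb_tiling \<T>"
  shows "infinite {f. frieze_pattern \<T> f \<and> card (f ` vertices \<T>) = 3}"
proof -
  obtain p a where marked: "\<And>R. R \<in> \<T> \<Longrightarrow> \<exists>d. marked_in p a d \<and> rhomb d = R"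
    using glb_tiling_marked[OF assms] by blast
  have "\<Union>\<T> = UNIV"
    using assms by (simp add: glb_tiling_def rhombus_tiling_def)
  then have "\<T> \<noteq> {}"
    by auto
  note image = index_frieze_image[OF marked this]
  define F where "F k = index_frieze p a (vertices \<T>) (int k + 1)" for k
  \<comment> \<open>The smallest value of a frieze in the family recovers its parameter.\<close>
  have "inj F"
  proof
    fix j k
    assume "F j = F k"
    then have "{int j + 1, int j + 1 + 1, int j + 1 + 2} = {int k + 1, int k + 1 + 1, int k + 1 + 2}"
      using image unfolding F_def by metis
    then have "Min {int j + 1, int j + 1 + 1, int j + 1 + 2}
        = Min {int k + 1, int k + 1 + 1, int k + 1 + 2}"
      by simp
    then show "j = k"
      by simp
  qed
  then have "infinite (range F)"
    by (rule range_inj_infinite)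
  moreover have "frieze_pattern \<T> (F k) \<and> card (F k ` vertices \<T>) = 3" for k
    using frieze_pattern_index_frieze[OF marked] image unfolding F_def by simp
  then have "range F \<subseteq> {f. frieze_pattern \<T> f \<and> card (f ` vertices \<T>) = 3}"
    by blast
  ultimately show ?thesis
    using infinite_super by blast
qed

end
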